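(* For every $I\subseteq\mathbb{N}$ let $(\psi_i^I)_{i\in I}$ be an anytime-valid test for $H_I$. Then $\boldsymbol{\phi}=(\phi_I)_{I\subseteq\mathbb{N}}$, where $$\phi_I=\inf\Big\{\sup_{i\in I}\psi_i^J:\ J\subseteq\mathbb{N},\ J\cap\{1,\ldots,\sup(I)\}=I\Big\},$$ is an increasing family of online intersection tests. In particular, for infinite $I\subseteq\mathbb{N}$, $\phi_I=\sup_{i\in I}\psi_i^I$.
   Context: Setting. $\mathbb{N}=\{1,2,\ldots\}$, $\alpha\in(0,1)$ is fixed, $\Omega$ is equipped with a filtration $(\mathcal{F}_i)_{i\in\mathbb{N}_0}$ with $\mathcal{F}_0=\{\emptyset,\Omega\}$, $\mathcal F_\infty=\sigma(\bigcup_i\mathcal F_i)$, and $\mathcal{P}$ is a set of probability distributions on this filtered measurable space. Null hypotheses are subsets $H_1,H_2,\ldots\subseteq\mathcal{P}$; for $I\subseteq\mathbb{N}$, $H_I=\bigcap_{i\in I}H_i$ (with $H_\emptyset=\mathcal{P}$). Anytime-valid test for $H_I$: a family $(\psi_i)_{i\in I}$ of $\{0,1\}$-valued random variables such that $\psi_i$ is $\mathcal{F}_i$-measurable for each $i\in I$ and $\mathbb{P}(\exists i\in I:\psi_i=1)\le\alpha$ for all $\mathbb{P}\in H_I$. Intersection test for $H_I$: a $\{0,1\}$-valued random variable $\phi_I$ with $\mathbb{P}(\phi_I=1)\le\alpha$ for all $\mathbb{P}\in H_I$. It is an online intersection test if it is $\mathcal{F}_{\sup(I)}$-measurable ($\mathcal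 F_\infty$ if $I$ is infinite). A family $(\phi_I)_{I\subseteq\mathbb{N}}$ is increasing if for all $i\in\mathbb{N}$, $I\subseteq\{1,\ldots,i\}$ and $K\subseteq\{k\in\mathbb{N}:k>i\}$ one has $\phi_I\le\phi_{I\cup K}$. Conventions: $\sup(\emptyset)=0$ for index sets; $\{1,\ldots,\sup(I)\}=\mathbb{N}$ if $I$ is infinite and $=\emptyset$ if $I=\emptyset$; the supremum of $\{0,1\}$-valued quantities over an empty index set is $0$.
   Formalization: For finite nonempty I it is assumed, not proved, that {φ_I = 1} lies in F_{sup(I)}: the infimum runs over uncountably many J, and φ_I can be non-measurable without this assumption. *)

theory Defs
  imports "HOL-Probability.Probability" "HOL-Library.Extended_Nat"
begin

definition F_infty :: "'a set \<Rightarrow> (nat \<Rightarrow> 'a measure) \<Rightarrow> 'a measure" where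
  "F_infty \<Omega> F = sigma \<Omega> (\<Union>i. sets (F i))"

text \<open>
  Time points of the filtration range over all of \<^typ>\<open>nat\<close>; hypotheses are indexed by
  \<open>{1..}\<close>, so the value \<open>H 0\<close> is irrelevant.
\<close>

locale online_testing = filtration \<Omega> F
  for \<Omega> :: "'a set" and F :: "nat \<Rightarrow> 'a measure" +
  fixes \<P> :: "'a measure set" and H :: "nat \<Rightarrow> 'a measure set" and \<alpha> :: real
  assumes sets_F_0: "sets (F 0) = {{}, \<Omega>}"
    and prob_space_\<P>: "\<And>Q. Q \<in> \<P> \<Longrightarrow> prob_space Q"
    and sets_\<P>: "\<And>Q. Q \<in> \<P> \<Longrightarrow> sets Q = sets (F_infty \<Omega> F)"
    and H_subset: "\<And>i. 1 \<le> i \<Longrightarrow> H i \<subseteq> \<P>"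
    and \<alpha>: "0 < \<alpha>" "\<alpha> < 1"

definition H_inter :: "'a measure set \<Rightarrow> (nat \<Rightarrow> 'a measure set) \<Rightarrow> nat set \<Rightarrow> 'a measure set" where
  "H_inter \<P> H I = \<P> \<inter> (\<Inter>i\<in>I. H i)"

text \<open>In \<^typ>\<open>enat\<close>, the supremum of the empty set is \<open>0\<close> and that of an infinite set of
  naturals is \<open>\<infinity>\<close>.\<close>

definition index_sup :: "nat set \<Rightarrow> enat" where
  "index_sup I = (SUP i\<in>I. enat i)"

definition upto_sup :: "nat set \<Rightarrow> nat set" where
  "upto_sup I = {j. 1 \<le> j \<and> enat j \<le> index_sup I}"

definition F_at :: "'a set \<Rightarrow> (nat \<Rightarrow> 'a measure) \<Rightarrow> enat \<Rightarrow> 'a measure" where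
  "F_at \<Omega> F n = (case n of enat k \<Rightarrow> F k | \<infinity> \<Rightarrow> F_infty \<Omega> F)"

context online_testing
begin

definition anytime_valid_test :: "nat set \<Rightarrow> (nat \<Rightarrow> 'a \<Rightarrow> nat) \<Rightarrow> bool" where
  "anytime_valid_test I \<psi> \<longleftrightarrow>
     (\<forall>i\<in>I. \<psi> i \<in> F i \<rightarrow>\<^sub>M count_space {0, 1}) \<and>
     (\<forall>Q\<in>H_inter \<P> H I. \<P>(\<omega> in Q. \<exists>i\<in>I. \<psi> i \<omega> = 1) \<le> \<alpha>)"

definition intersection_test :: "nat set \<Rightarrow> ('a \<Rightarrow> nat) \<Rightarrow> bool" where
  "intersection_test I \<phi> \<longleftrightarrow>
     \<phi> \<in> F_infty \<Omega> F \<rightarrow>\<^sub>M count_space {0, 1} \<and>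
     (\<forall>Q\<in>H_inter \<P> H I. \<P>(\<omega> in Q. \<phi> \<omega> = 1) \<le> \<alpha>)"

definition online_intersection_test :: "nat set \<Rightarrow> ('a \<Rightarrow> nat) \<Rightarrow> bool" where
  "online_intersection_test I \<phi> \<longleftrightarrow>
     intersection_test I \<phi> \<and>
     \<phi> \<in> F_at \<Omega> F (index_sup I) \<rightarrow>\<^sub>M count_space {0, 1}"

definition increasing_family :: "(nat set \<Rightarrow> 'a \<Rightarrow> nat) \<Rightarrow> bool" where
  "increasing_family \<phi> \<longleftrightarrow>
     (\<forall>i\<ge>1. \<forall>I K. I \<subseteq> {1..i} \<longrightarrow> K \<subseteq> {i<..} \<longrightarrow> (\<forall>\<omega>\<in>\<Omega>. \<phi> I \<omega> \<le> \<phi> (I \<union> K) \<omega>))"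

end

text \<open>
  For \<open>{0, 1}\<close>-valued \<open>\<psi>\<close>, the supremum in \<^typ>\<open>nat\<close> over a possibly infinite \<open>I\<close> is the
  usual one, with value \<open>0\<close> for \<open>I = {}\<close>; the infimum ranges over a family containing \<open>J = I\<close>.

  For finite nonempty \<open>I\<close> that family is uncountable, so \<open>sup_inf_test \<psi> I\<close> can fail to be
  measurable even if every \<open>\<psi> J i\<close> is. For instance, let \<open>F i\<close> be the Borel sets of the real
  line for \<open>i \<ge> 1\<close>, let the only distribution be the point mass at \<open>0\<close>, let
  \<open>{\<psi> J 1 = 1} = UNIV - {0, x J}\<close> for \<open>1 \<in> J\<close> where \<open>x\<close> maps the sets \<open>J\<close> onto a non-Borel set,
  and let all other \<open>\<psi> J i\<close> be \<open>0\<close>. Measurability of these infima hence has to be assumed.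
\<close>

definition sup_inf_test :: "(nat set \<Rightarrow> nat \<Rightarrow> 'a \<Rightarrow> nat) \<Rightarrow> nat set \<Rightarrow> 'a \<Rightarrow> nat" where
  "sup_inf_test \<psi> I \<omega> = (INF J\<in>{J. J \<subseteq> {1..} \<and> J \<inter> upto_sup I = I}. SUP i\<in>I. \<psi> J i \<omega>)"

end

theory Submission
  imports Defs
begin

text \<open>
  The set \<open>I\<close> itself is among the \<open>J\<close> in the infimum, so the combined test rejects only where the
  anytime-valid test for \<open>I\<close> does, which bounds its error. Every \<open>J\<close> admissible for \<open>I \<union> K\<close>,
  where \<open>K\<close> lies beyond \<open>I\<close>, is admissible for \<open>I\<close>, so passing from \<open>I\<close> to \<open>I \<union> K\<close> shrinks the
  range of the infimum and enlarges each supremum.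
\<close>

section \<open>Zero-one valued functions: suprema and measurability\<close>

lemma SUP_zero_one:
  fixes f :: "'b \<Rightarrow> nat"
  assumes "\<And>i. i \<in> A \<Longrightarrow> f i \<in> {0, 1}"
  shows "(SUP i\<in>A. f i) = (if \<exists>i\<in>A. f i = 1 then 1 else 0)"
proof -
  \<comment> \<open>Listing 1 first lets \<open>subset_insert\<close> strip it off when 1 is not
    attained.\<close>
  have sub: "f ` A \<subseteq> {1, 0}"
    using assms by (subst insert_commute) (rule image_subsetI)
  show ?thesis
  proof (cases "1 \<in> f ` A")
    case True
    \<comment> \<open>On \<open>nat\<close>, \<open>Sup\<close> of a nonempty set is
      \<open>Max\<close>, which is meaningful here even for infinite \<open>A\<close>, as the image
      has at most two elements.\<close>
    have "Max (f ` A) = 1"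
    proof (rule Max_eqI)
      show "finite (f ` A)"
        using sub by (rule finite_subset) simp
      show "y \<le> 1" if "y \<in> f ` A" for y
        using subsetD[OF sub that] by auto
    qed (rule True)
    moreover have "f ` A \<noteq> {}" "\<exists>i\<in>A. f i = 1"
      using True by force+
    ultimately show ?thesis
      by (simp only: Sup_nat_def if_True if_False)
  next
    case False
    \<comment> \<open>Both cases give 0, the first because \<open>Sup {} = 0\<close> on
      \<open>nat\<close>.\<close>
    then have "f ` A = {} \<or> f ` A = {0}"
      by (rule subset_singletonD[OF iffD1[OF subset_insert sub]])
    then have "(SUP i\<in>A. f i) = 0"
      by (elim disjE) (simp_all add: Sup_nat_def)
    moreover have "\<not> (\<exists>i\<in>A. f i = 1)"
      using False by (metis imageI)
    ultimately show ?thesis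
      by (simp only: if_False)
  qed
qed

text \<open>The event where \<open>f\<close> is 0 is the complement of the event where it is 1. All
  measurability questions about tests thus reduce to rejection events.\<close>

lemma measurable_zero_one_iff:
  fixes f :: "'a \<Rightarrow> nat"
  shows "f \<in> M \<rightarrow>\<^sub>M count_space {0, 1} \<longleftrightarrow>
    f \<in> space M \<rightarrow> {0, 1} \<and> {x \<in> space M. f x = 1} \<in> sets M" (is "?L \<longleftrightarrow> ?R")
proof
  assume L: ?L
  have "f -` {1} \<inter> space M \<in> sets M"
    using L by (rule measurable_sets) simp
  moreover have "f -` {1} \<inter> space M = {x \<in> space M. f x = 1}"
    by blast
  moreover have "f \<in> space M \<rightarrow> {0, 1}"
    using measurable_space[OF L] by simp
  ultimately show ?R
    by simp
next
  assume R: ?R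
  have "f -` {1} \<inter> space M = {x \<in> space M. f x = 1}"
    by blast
  moreover have "f -` {0} \<inter> space M = space M - {x \<in> space M. f x = 1}"
    using R by force
  ultimately show ?L
    using R by (subst measurable_count_space_eq2) auto
qed

section \<open>Suprema of index sets and the initial segments they determine\<close>

lemma index_sup_finite:
  assumes "finite I" "I \<noteq> {}"
  shows "index_sup I = enat (Max I)"
  unfolding index_sup_def
proof (rule antisym)
  show "(SUP i\<in>I. enat i) \<le> enat (Max I)"
    using assms by (auto intro: SUP_least)
  show "enat (Max I) \<le> (SUP i\<in>I. enat i)"
    using assms by (intro SUP_upper Max_in)
qed

lemma index_sup_infinite:
  assumes "infinite I"
  shows "index_sup I = \<infinity>"
proof (rule ccontr)
  assume "index_sup I \<noteq> \<infinity>"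
  then obtain k where "index_sup I = enat k"
    by auto
  then have "enat i \<le> enat k" if "i \<in> I" for i
    using that by (metis SUP_upper index_sup_def)
  then have "I \<subseteq> {..k}"
    by auto
  then show False
    using assms finite_subset by blast
qed

lemma index_sup_mono: "I \<subseteq> J \<Longrightarrow> index_sup I \<le> index_sup J"
  unfolding index_sup_def by (rule SUP_subset_mono) auto

lemma upto_sup_mono: "I \<subseteq> J \<Longrightarrow> upto_sup I \<subseteq> upto_sup J"
  unfolding upto_sup_def using index_sup_mono[of I J]
  by (auto intro: order_trans[of _ "index_sup I" "index_sup J"])

lemma upto_sup_bound:
  assumes "I \<subseteq> {1..n}"
  shows "upto_sup I \<subseteq> {1..n}"
proof -
  have "index_sup I \<le> enat n"
    unfolding index_sup_def using assms by (auto intro!: SUP_least)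
  then show ?thesis
    unfolding upto_sup_def by (auto dest: order_trans[of _ "index_sup I" "enat n"])
qed

lemma subset_upto_sup: "I \<subseteq> {1..} \<Longrightarrow> I \<subseteq> upto_sup I"
  unfolding upto_sup_def index_sup_def by (auto intro: SUP_upper)

section \<open>Index sets admissible in the infimum\<close>

definition extensions :: "nat set \<Rightarrow> nat set set" where
  "extensions I = {J. J \<subseteq> {1..} \<and> J \<inter> upto_sup I = I}"

lemma sup_inf_test_extensions:
  "sup_inf_test \<psi> I \<omega> = (INF J\<in>extensions I. SUP i\<in>I. \<psi> J i \<omega>)"
  by (simp add: sup_inf_test_def extensions_def)

lemma extensions_self: "I \<subseteq> {1..} \<Longrightarrow> I \<in> extensions I"
  using subset_upto_sup by (auto simp: extensions_def)

text \<open>An infinite \<open>I\<close> has supremum \<infinity>, so \<open>J\<close> has to agree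
  with \<open>I\<close> on all of \<open>{1..}\<close>.\<close>

lemma extensions_infinite:
  assumes "I \<subseteq> {1..}" "infinite I"
  shows "extensions I = {I}"
proof -
  have "upto_sup I = {1..}"
    using index_sup_infinite[OF assms(2)] by (auto simp: upto_sup_def)
  then show ?thesis
    using assms(1) by (auto simp: extensions_def)
qed

text \<open>Agreement of \<open>J\<close> with \<open>I \<union> K\<close> on the longer segment
  restricts to \<open>upto_sup I\<close>. That segment stays within \<open>{1..i}\<close>, where
  \<open>K\<close> has no elements.\<close>

lemma extensions_Un:
  assumes "I \<subseteq> {1..i}" "K \<subseteq> {i<..}"
  shows "extensions (I \<union> K) \<subseteq> extensions I"
proof
  fix J assume "J \<in> extensions (I \<union> K)"
  then have J: "J \<subseteq> {1..}" "J \<inter> upto_sup (I \<union> K) = I \<union> K"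
    by (auto simp: extensions_def)
  have "I \<subseteq> upto_sup I"
    using assms(1) by (intro subset_upto_sup) auto
  have "upto_sup I \<subseteq> upto_sup (I \<union> K)"
    by (rule upto_sup_mono) simp
  then have "J \<inter> upto_sup I = (I \<union> K) \<inter> upto_sup I"
    using J(2) by blast
  also have "K \<inter> upto_sup I = {}"
    using upto_sup_bound[OF assms(1)] assms(2) by (force simp: subset_iff)
  then have "(I \<union> K) \<inter> upto_sup I = I"
    using \<open>I \<subseteq> upto_sup I\<close> by blast
  finally show "J \<in> extensions I"
    using J(1) by (simp add: extensions_def)
qed

lemma sup_inf_test_le:
  assumes "J \<in> extensions I"
  shows "sup_inf_test \<psi> I \<omega> \<le> (SUP i\<in>I. \<psi> J i \<omega>)"
  unfolding sup_inf_test_extensions using assms by (intro cINF_lower) auto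

lemma sup_inf_test_empty: "sup_inf_test \<psi> {} \<omega> = 0"
  using sup_inf_test_le[OF extensions_self, of "{}"] by simp

lemma sup_inf_test_infinite:
  "I \<subseteq> {1..} \<Longrightarrow> infinite I \<Longrightarrow> sup_inf_test \<psi> I \<omega> = (SUP i\<in>I. \<psi> I i \<omega>)"
  by (simp add: sup_inf_test_extensions extensions_infinite)

section \<open>Error bound, monotonicity and measurability of the combined test\<close>

context online_testing
begin

lemma space_F_infty: "space (F_infty \<Omega> F) = \<Omega>"
  by (simp add: F_infty_def space_measure_of_conv)

lemma sets_F_subset_F_infty: "sets (F i) \<subseteq> sets (F_infty \<Omega> F)"
proof -
  \<comment> \<open>Only for generators inside \<open>Pow \<Omega>\<close> are the sets of
    \<open>sigma\<close> the generated sigma-algebra; otherwise a default applies.\<close>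
  have "(\<Union>i. sets (F i)) \<subseteq> Pow \<Omega>"
    using sets.sets_into_space space_F by fastforce
  then show ?thesis
    unfolding F_infty_def by (auto simp: sets_measure_of)
qed

context
  fixes \<psi> :: "nat set \<Rightarrow> nat \<Rightarrow> 'a \<Rightarrow> nat"
  assumes valid: "\<And>I. I \<subseteq> {1..} \<Longrightarrow> anytime_valid_test I (\<psi> I)"
begin

lemma psi_zero_one: "J \<subseteq> {1..} \<Longrightarrow> i \<in> J \<Longrightarrow> \<omega> \<in> \<Omega> \<Longrightarrow> \<psi> J i \<omega> \<in> {0, 1}"
  using valid[of J] unfolding anytime_valid_test_def measurable_zero_one_iff space_F by blast

text \<open>Two index sets occur because the infimum evaluates the test for \<open>J\<close> only at
  the indices in \<open>I\<close>.\<close>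

lemma SUP_psi:
  assumes "J \<subseteq> {1..}" "I \<subseteq> J" "\<omega> \<in> \<Omega>"
  shows "(SUP i\<in>I. \<psi> J i \<omega>) = (if \<exists>i\<in>I. \<psi> J i \<omega> = 1 then 1 else 0)"
  by (rule SUP_zero_one) (use assms psi_zero_one in blast)

lemma sup_inf_test_zero_one:
  assumes "I \<subseteq> {1..}" "\<omega> \<in> \<Omega>"
  shows "sup_inf_test \<psi> I \<omega> \<in> {0, 1}"
proof -
  have "sup_inf_test \<psi> I \<omega> \<le> (SUP i\<in>I. \<psi> I i \<omega>)"
    using assms(1) by (intro sup_inf_test_le extensions_self)
  also have "\<dots> \<le> 1"
    using assms by (simp add: SUP_psi)
  finally show ?thesis
    by auto
qed

lemma increasing_sup_inf_test: "increasing_family (sup_inf_test \<psi>)"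
  unfolding increasing_family_def
proof (intro allI impI ballI)
  fix i :: nat and I K \<omega>
  assume I: "I \<subseteq> {1..i}" and K: "K \<subseteq> {i<..}" and \<omega>: "\<omega> \<in> \<Omega>"
  have IK: "I \<union> K \<subseteq> {1..}"
    using I K by fastforce
  show "sup_inf_test \<psi> I \<omega> \<le> sup_inf_test \<psi> (I \<union> K) \<omega>"
    unfolding sup_inf_test_extensions[of \<psi> "I \<union> K" \<omega>]
  proof (rule cINF_greatest)
    show "extensions (I \<union> K) \<noteq> {}"
      using extensions_self[OF IK] by blast
    fix J assume J: "J \<in> extensions (I \<union> K)"
    have sub: "J \<subseteq> {1..}" "I \<union> K \<subseteq> J"
      using J by (auto simp: extensions_def)
    have "sup_inf_test \<psi> I \<omega> \<le> (SUP i\<in>I. \<psi> J i \<omega>)"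
      using J extensions_Un[OF I K] by (intro sup_inf_test_le) blast
    \<comment> \<open>\<open>K\<close> may be infinite. Writing both suprema as indicators reduces
      the inequality to this: a rejecting index in \<open>I\<close> is also one in
      \<open>I \<union> K\<close>.\<close>
    also have "\<dots> \<le> (SUP i\<in>I \<union> K. \<psi> J i \<omega>)"
      using sub \<omega> by (auto simp: SUP_psi)
    finally show "sup_inf_test \<psi> I \<omega> \<le> (SUP i\<in>I \<union> K. \<psi> J i \<omega>)" .
  qed
qed

text \<open>The event is a countable union of events from the \<open>F i\<close>. It dominates the
  combined rejection event in the error bound and equals it for infinite \<open>I\<close>.\<close>

lemma rejection_in_F_infty:
  assumes "I \<subseteq> {1..}"
  shows "{\<omega> \<in> \<Omega>. \<exists>i\<in>I. \<psi> I i \<omega> = 1} \<in> sets (F_infty \<Omega> F)"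
proof -
  have "{\<omega> \<in> \<Omega>. \<psi> I i \<omega> = 1} \<in> sets (F_infty \<Omega> F)" if "i \<in> I" for i
    using valid[OF assms] that sets_F_subset_F_infty[of i]
    unfolding anytime_valid_test_def measurable_zero_one_iff space_F by blast
  then have "(\<Union>i\<in>I. {\<omega> \<in> \<Omega>. \<psi> I i \<omega> = 1}) \<in> sets (F_infty \<Omega> F)"
    by (intro sets.countable_UN') auto
  also have "(\<Union>i\<in>I. {\<omega> \<in> \<Omega>. \<psi> I i \<omega> = 1}) = {\<omega> \<in> \<Omega>. \<exists>i\<in>I. \<psi> I i \<omega> = 1}"
    by auto
  finally show ?thesis .
qed

lemma prob_sup_inf_test:
  assumes I: "I \<subseteq> {1..}" and Q: "Q \<in> H_inter \<P> H I"
  shows "\<P>(\<omega> in Q. sup_inf_test \<psi> I \<omega> = 1) \<le> \<alpha>"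
proof -
  have QP: "Q \<in> \<P>"
    using Q by (auto simp: H_inter_def)
  interpret Q: prob_space Q
    by (rule prob_space_\<P>[OF QP])
  have space_Q: "space Q = \<Omega>"
    using sets_eq_imp_space_eq[OF sets_\<P>[OF QP]] by (simp add: space_F_infty)
  have "\<P>(\<omega> in Q. sup_inf_test \<psi> I \<omega> = 1) \<le> \<P>(\<omega> in Q. \<exists>i\<in>I. \<psi> I i \<omega> = 1)"
  proof (rule Q.finite_measure_mono)
    show "{\<omega> \<in> space Q. sup_inf_test \<psi> I \<omega> = 1} \<subseteq> {\<omega> \<in> space Q. \<exists>i\<in>I. \<psi> I i \<omega> = 1}"
    proof safe
      \<comment> \<open>Taking \<open>J = I\<close>, the supremum is at least 1, so some test in the
        family for \<open>I\<close> rejects.\<close>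
      fix \<omega> assume "\<omega> \<in> space Q" "sup_inf_test \<psi> I \<omega> = 1"
      then show "\<exists>i\<in>I. \<psi> I i \<omega> = 1"
        using sup_inf_test_le[OF extensions_self[OF I], of \<psi> \<omega>] SUP_psi[OF I order_refl, of \<omega>]
        by (auto simp: space_Q split: if_splits)
    qed
    show "{\<omega> \<in> space Q. \<exists>i\<in>I. \<psi> I i \<omega> = 1} \<in> Q.events"
      using rejection_in_F_infty[OF I] by (simp add: space_Q sets_\<P>[OF QP])
  qed
  also have "\<dots> \<le> \<alpha>"
    using valid[OF I] Q by (auto simp: anytime_valid_test_def)
  finally show ?thesis .
qed

text \<open>For empty \<open>I\<close> the test never rejects; for infinite \<open>I\<close> the
  infimum has the single member \<open>J = I\<close>. For finite nonempty \<open>I\<close> the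
  infimum runs over uncountably many \<open>J\<close>, and \<open>fin\<close> supplies the
  measurability.\<close>

lemma online_sup_inf_test:
  assumes I: "I \<subseteq> {1..}"
    and fin: "finite I \<Longrightarrow> I \<noteq> {} \<Longrightarrow> {\<omega> \<in> \<Omega>. sup_inf_test \<psi> I \<omega> = 1} \<in> sets (F (Max I))"
  shows "online_intersection_test I (sup_inf_test \<psi> I)"
proof -
  let ?R = "{\<omega> \<in> \<Omega>. sup_inf_test \<psi> I \<omega> = 1}"
  have space_F_at: "space (F_at \<Omega> F n) = \<Omega>" for n
    by (cases n) (auto simp: F_at_def space_F space_F_infty)
  have F_at_subset: "sets (F_at \<Omega> F n) \<subseteq> sets (F_infty \<Omega> F)" for n
    using sets_F_subset_F_infty by (cases n) (auto simp: F_at_def)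
  have R: "?R \<in> sets (F_at \<Omega> F (index_sup I))"
  proof -
    consider "I = {}" | "finite I" "I \<noteq> {}" | "infinite I"
      by blast
    then show ?thesis
    proof cases
      case 1
      then show ?thesis
        by (simp add: sup_inf_test_empty)
    next
      case 2
      then show ?thesis
        using fin by (simp add: index_sup_finite F_at_def)
    next
      case 3
      then have "?R = {\<omega> \<in> \<Omega>. \<exists>i\<in>I. \<psi> I i \<omega> = 1}"
        using sup_inf_test_infinite[OF I 3] SUP_psi[OF I order_refl]
        by (metis (mono_tags, lifting) zero_neq_one)
      then show ?thesis
        using 3 rejection_in_F_infty[OF I] by (simp add: index_sup_infinite F_at_def)
    qed
  qed
  have "sup_inf_test \<psi> I \<in> \<Omega> \<rightarrow> {0, 1}"
    using sup_inf_test_zero_one[OF I] by blast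
  \<comment> \<open>Measurability at time sup(\<open>I\<close>) passes to the terminal
    sigma-algebra, as an intersection test requires.\<close>
  moreover have "?R \<in> sets (F_infty \<Omega> F)"
    using R F_at_subset by blast
  ultimately show ?thesis
    using R prob_sup_inf_test[OF I]
    unfolding online_intersection_test_def intersection_test_def measurable_zero_one_iff
      space_F_at space_F_infty by blast
qed

end

end

theorem theorem2p2:
  fixes \<Omega> :: "'a set" and F :: "nat \<Rightarrow> 'a measure"
    and \<P> :: "'a measure set" and H :: "nat \<Rightarrow> 'a measure set" and \<alpha> :: real
    and \<psi> :: "nat set \<Rightarrow> nat \<Rightarrow> 'a \<Rightarrow> nat"
  assumes setting: "online_testing \<Omega> F \<P> H \<alpha>"
    and valid: "\<And>I. I \<subseteq> {1..} \<Longrightarrow> online_testing.anytime_valid_test F \<P> H \<alpha> I (\<psi> I)"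
    and infimum_measurable: "\<And>I. I \<subseteq> {1..} \<Longrightarrow> finite I \<Longrightarrow> I \<noteq> {} \<Longrightarrow>
           {\<omega> \<in> \<Omega>. sup_inf_test \<psi> I \<omega> = 1} \<in> sets (F (Max I))"
  shows "online_testing.increasing_family \<Omega> (sup_inf_test \<psi>) \<and>
         (\<forall>I\<subseteq>{1..}. online_testing.online_intersection_test \<Omega> F \<P> H \<alpha> I (sup_inf_test \<psi> I)) \<and>
         (\<forall>I\<subseteq>{1..}. infinite I \<longrightarrow>
            (\<forall>\<omega>\<in>\<Omega>. sup_inf_test \<psi> I \<omega> = (SUP i\<in>I. \<psi> I i \<omega>)))"
proof -
  interpret online_testing \<Omega> F \<P> H \<alpha>
    by (rule setting)
  show ?thesis
  proof (intro conjI allI impI ballI)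
    show "increasing_family (sup_inf_test \<psi>)"
      by (rule increasing_sup_inf_test[OF valid])
    show "online_intersection_test I (sup_inf_test \<psi> I)" if "I \<subseteq> {1..}" for I
      by (rule online_sup_inf_test[OF valid that infimum_measurable[OF that]])
    show "sup_inf_test \<psi> I \<omega> = (SUP i\<in>I. \<psi> I i \<omega>)"
      if "I \<subseteq> {1..}" "infinite I" for I \<omega>
      by (rule sup_inf_test_infinite[OF that])
  qed
qed

end
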